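(* Let $R$ be a commutative ring with identity, $S$ a multiplicatively closed subset of $R$, $M$ a unital $R$-module, and $K\subseteq N$ two submodules of $M$. (1) If $N$ is a weakly $S$-primary submodule of $M$, then $N/K$ is a weakly $S$-primary submodule of $M/K$. (2) If $K'$ is a weakly $S$-primary submodule of $M$, then $K'\cap N$ is a weakly $S$-primary submodule of $N$. (3) If $N/K$ is a weakly $S$-primary submodule of $M/K$ and $K$ is an $S$-primary (respectively, weakly $S$-primary) submodule of $M$, then $N$ is an $S$-primary (respectively, weakly $S$-primary) submodule of $M$.
   Context: A multiplicatively closed subset of $R$ is a non-empty subset closed under multiplication. $(N:_R M)=\{r\in R: rM\subseteq N\}$. A submodule $N$ of $M$ with $(N:_R M)\cap S=\emptyset$ is $S$-primary (resp. weakly $S$-primary) if there exists a fixed $s\in S$ such that for all $a\in R$ and $m\in M$, $am\in N$ (resp. $0\neq am\in N$) implies $sa\in\sqrt{(N:_R M)}$ or $sm\in N$.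
   Formalization: Part (2) additionally assumes that (K'∩N :_R N) is disjoint from S; without this it fails, e.g. for R = M = Z, S = {1}, K = 0, N = K' = 2Z, where K'∩N = N is not a weakly S-primary submodule of N. *)

theory Defs
  imports "HOL-Algebra.Module" "HOL-Algebra.QuotRing"
begin

definition mult_closed_subset :: "('a, 'r) ring_scheme \<Rightarrow> 'a set \<Rightarrow> bool" where
  "mult_closed_subset R S \<longleftrightarrow>
     S \<subseteq> carrier R \<and> S \<noteq> {} \<and> (\<forall>s\<in>S. \<forall>t\<in>S. s \<otimes>\<^bsub>R\<^esub> t \<in> S)"

definition radical :: "('a, 'r) ring_scheme \<Rightarrow> 'a set \<Rightarrow> 'a set" where
  "radical R I = {r \<in> carrier R. \<exists>n::nat. n > 0 \<and> r [^]\<^bsub>R\<^esub> n \<in> I}"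

text \<open>The residual \<open>(N :\<^sub>R M)\<close>.\<close>

definition residual ::
    "('a, 'r) ring_scheme \<Rightarrow> ('a, 'b, 'm) module_scheme \<Rightarrow> 'b set \<Rightarrow> 'a set" where
  "residual R M N = {r \<in> carrier R. \<forall>m\<in>carrier M. r \<odot>\<^bsub>M\<^esub> m \<in> N}"

definition S_primary ::
    "('a, 'r) ring_scheme \<Rightarrow> 'a set \<Rightarrow> ('a, 'b, 'm) module_scheme \<Rightarrow> 'b set \<Rightarrow> bool" where
  "S_primary R S M N \<longleftrightarrow>
     submodule N R M \<and> residual R M N \<inter> S = {} \<and>
     (\<exists>s\<in>S. \<forall>a\<in>carrier R. \<forall>m\<in>carrier M.
        a \<odot>\<^bsub>M\<^esub> m \<in> N \<longrightarrow>
        s \<otimes>\<^bsub>R\<^esub> a \<in> radical R (residual R M N) \<or> s \<odot>\<^bsub>M\<^esub> m \<in> N)"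

definition weakly_S_primary ::
    "('a, 'r) ring_scheme \<Rightarrow> 'a set \<Rightarrow> ('a, 'b, 'm) module_scheme \<Rightarrow> 'b set \<Rightarrow> bool" where
  "weakly_S_primary R S M N \<longleftrightarrow>
     submodule N R M \<and> residual R M N \<inter> S = {} \<and>
     (\<exists>s\<in>S. \<forall>a\<in>carrier R. \<forall>m\<in>carrier M.
        \<zero>\<^bsub>M\<^esub> \<noteq> a \<odot>\<^bsub>M\<^esub> m \<and> a \<odot>\<^bsub>M\<^esub> m \<in> N \<longrightarrow>
        s \<otimes>\<^bsub>R\<^esub> a \<in> radical R (residual R M N) \<or> s \<odot>\<^bsub>M\<^esub> m \<in> N)"

text \<open>
  The quotient module \<open>M/K\<close> has the additive cosets of \<open>K\<close> as elements. The scalar action is given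
  on cosets as in the definition of \<^const>\<open>rcoset_mult\<close>; it satisfies \<open>a (K + x) = K + a x\<close>, see
  \<open>smult_coset\<close> below. The ring-multiplication fields of the record play no role for modules.
\<close>

definition quotient_module ::
    "('a, 'b, 'm) module_scheme \<Rightarrow> 'b set \<Rightarrow> ('a, 'b set) module" where
  "quotient_module M K =
     \<lparr>carrier = a_rcosets\<^bsub>M\<^esub> K, monoid.mult = undefined, one = undefined,
      zero = K, add = set_add M,
      smult = (\<lambda>a X. \<Union>x\<in>X. K +>\<^bsub>M\<^esub> (a \<odot>\<^bsub>M\<^esub> x))\<rparr>"

text \<open>\<open>N/K\<close> as a subset of \<open>M/K\<close>.\<close>

definition quotient_submodule ::
    "('a, 'b, 'm) module_scheme \<Rightarrow> 'b set \<Rightarrow> 'b set \<Rightarrow> 'b set set" where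
  "quotient_submodule M N K = (\<lambda>n. K +>\<^bsub>M\<^esub> n) ` N"

context module
begin

lemma submodule_abelian_subgroup:
  assumes "submodule K R M" shows "abelian_subgroup K M"
proof -
  have "subgroup K (add_monoid M)" using assms by (simp add: submodule_def)
  then show ?thesis
    by (intro abelian_subgroupI3 additive_subgroup.intro) (auto intro: M.abelian_group_axioms)
qed

lemma coset_eq_iff:
  assumes K: "submodule K R M" and x: "x \<in> carrier M" and y: "y \<in> carrier M"
  shows "K +>\<^bsub>M\<^esub> x = K +>\<^bsub>M\<^esub> y \<longleftrightarrow> x \<ominus>\<^bsub>M\<^esub> y \<in> K"
proof -
  interpret K: abelian_subgroup K M by (rule submodule_abelian_subgroup[OF K])
  have "x \<ominus>\<^bsub>M\<^esub> y \<in> K \<longleftrightarrow> x \<in> K +>\<^bsub>M\<^esub> y"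
    using K.a_rcos_module[OF y x] by (simp add: M.minus_eq)
  also have "\<dots> \<longleftrightarrow> K +>\<^bsub>M\<^esub> x = K +>\<^bsub>M\<^esub> y"
    using K.a_repr_independence'[OF _ y, of x] K.a_rcos_self[OF x] by auto
  finally show ?thesis by simp
qed

lemma smult_coset:
  assumes K: "submodule K R M" and a: "a \<in> carrier R" and x: "x \<in> carrier M"
  shows "a \<odot>\<^bsub>quotient_module M K\<^esub> (K +>\<^bsub>M\<^esub> x) = K +>\<^bsub>M\<^esub> (a \<odot>\<^bsub>M\<^esub> x)"
proof -
  interpret K: abelian_subgroup K M by (rule submodule_abelian_subgroup[OF K])
  have "K +>\<^bsub>M\<^esub> (a \<odot>\<^bsub>M\<^esub> y) = K +>\<^bsub>M\<^esub> (a \<odot>\<^bsub>M\<^esub> x)" if y: "y \<in> K +>\<^bsub>M\<^esub> x" for y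
  proof -
    have yc: "y \<in> carrier M" using y x K.a_subset M.a_r_coset_subset_G by blast
    have "y \<ominus>\<^bsub>M\<^esub> x \<in> K"
      using K.a_rcos_module[OF x yc] y by (simp add: M.minus_eq)
    then have "a \<odot>\<^bsub>M\<^esub> (y \<ominus>\<^bsub>M\<^esub> x) \<in> K" using submoduleE(4)[OF K a] by simp
    moreover have "a \<odot>\<^bsub>M\<^esub> (y \<ominus>\<^bsub>M\<^esub> x) = a \<odot>\<^bsub>M\<^esub> y \<ominus>\<^bsub>M\<^esub> a \<odot>\<^bsub>M\<^esub> x"
      using a x yc by (simp add: M.minus_eq smult_r_distr smult_r_minus)
    ultimately show ?thesis using coset_eq_iff[OF K] a x yc by simp
  qed
  moreover have "x \<in> K +>\<^bsub>M\<^esub> x" using K.a_rcos_self x by simp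
  ultimately have "(\<Union>y\<in>K +>\<^bsub>M\<^esub> x. K +>\<^bsub>M\<^esub> (a \<odot>\<^bsub>M\<^esub> y)) = K +>\<^bsub>M\<^esub> (a \<odot>\<^bsub>M\<^esub> x)"
    by (intro UN_constant_eq) blast+
  then show ?thesis by (simp only: quotient_module_def module.simps)
qed

lemma coset_add:
  assumes "submodule K R M" "x \<in> carrier M" "y \<in> carrier M"
  shows "(K +>\<^bsub>M\<^esub> x) \<oplus>\<^bsub>quotient_module M K\<^esub> (K +>\<^bsub>M\<^esub> y) = K +>\<^bsub>M\<^esub> (x \<oplus>\<^bsub>M\<^esub> y)"
proof -
  interpret K: abelian_subgroup K M by (rule submodule_abelian_subgroup[OF assms(1)])
  show ?thesis using assms by (simp add: quotient_module_def K.a_rcos_sum)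
qed

lemma carrier_quotient_module:
  "carrier (quotient_module M K) = (\<lambda>x. K +>\<^bsub>M\<^esub> x) ` carrier M"
  by (auto simp: quotient_module_def A_RCOSETS_def')

lemma quotient_module_is_module:
  assumes K: "submodule K R M"
  shows "module R (quotient_module M K)"
proof -
  interpret K: abelian_subgroup K M by (rule submodule_abelian_subgroup[OF K])
  have zero: "\<zero>\<^bsub>quotient_module M K\<^esub> = K +>\<^bsub>M\<^esub> \<zero>\<^bsub>M\<^esub>"
    using K.a_subset by (simp add: quotient_module_def)
  note q = carrier_quotient_module zero coset_add[OF K] smult_coset[OF K]
  show ?thesis
  proof (rule moduleI)
    show "cring R" by (rule R.is_cring)
    show "abelian_group (quotient_module M K)"
    proof (rule abelian_groupI)
      fix X assume "X \<in> carrier (quotient_module M K)"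
      then obtain x where x: "x \<in> carrier M" "X = K +>\<^bsub>M\<^esub> x" by (auto simp: q)
      show "\<exists>Y\<in>carrier (quotient_module M K).
              Y \<oplus>\<^bsub>quotient_module M K\<^esub> X = \<zero>\<^bsub>quotient_module M K\<^esub>"
        by (rule bexI[of _ "K +>\<^bsub>M\<^esub> (\<ominus>\<^bsub>M\<^esub> x)"]) (use x in \<open>auto simp: q M.l_neg\<close>)
    qed (auto simp: q M.a_ac)
  qed (auto simp: q smult_l_distr smult_r_distr smult_assoc1)
qed

lemma quotient_submodule_is_submodule:
  assumes K: "submodule K R M" and N: "submodule N R M"
  shows "submodule (quotient_submodule M N K) R (quotient_module M K)"
proof -
  interpret Q: module R "quotient_module M K" by (rule quotient_module_is_module[OF K])
  interpret K: abelian_subgroup K M by (rule submodule_abelian_subgroup[OF K])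
  note NE = submoduleE[OF N]
  have N0: "\<zero>\<^bsub>M\<^esub> \<in> N" using N subgroup.one_closed[of N "add_monoid M"] by (simp add: submodule_def)
  have zero: "\<zero>\<^bsub>quotient_module M K\<^esub> = K +>\<^bsub>M\<^esub> \<zero>\<^bsub>M\<^esub>"
    using K.a_subset by (simp add: quotient_module_def)
  note q = carrier_quotient_module zero coset_add[OF K] smult_coset[OF K]
  have neg: "\<ominus>\<^bsub>quotient_module M K\<^esub> (K +>\<^bsub>M\<^esub> x) = K +>\<^bsub>M\<^esub> (\<ominus>\<^bsub>M\<^esub> x)" if "x \<in> carrier M" for x
    by (rule Q.minus_equality) (use that in \<open>auto simp: q M.l_neg\<close>)
  show ?thesis
  proof (rule Q.submoduleI)
    show "quotient_submodule M N K \<subseteq> carrier (quotient_module M K)"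
      unfolding quotient_submodule_def q(1) using NE(1) by (rule image_mono)
    show "\<zero>\<^bsub>quotient_module M K\<^esub> \<in> quotient_submodule M N K"
      unfolding quotient_submodule_def zero using N0 by (rule imageI)
  next
    fix X assume "X \<in> quotient_submodule M N K"
    then obtain x where x: "x \<in> N" "X = K +>\<^bsub>M\<^esub> x" by (auto simp: quotient_submodule_def)
    then have xc: "x \<in> carrier M" using NE(1) by blast
    show "\<ominus>\<^bsub>quotient_module M K\<^esub> X \<in> quotient_submodule M N K"
      unfolding x(2) neg[OF xc] quotient_submodule_def using NE(3)[OF x(1)] by (rule imageI)
    show "a \<odot>\<^bsub>quotient_module M K\<^esub> X \<in> quotient_submodule M N K" if a: "a \<in> carrier R" for a
      unfolding x(2) smult_coset[OF K a xc] quotient_submodule_def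
      using NE(4)[OF a x(1)] by (rule imageI)
    show "X \<oplus>\<^bsub>quotient_module M K\<^esub> Y \<in> quotient_submodule M N K"
      if "Y \<in> quotient_submodule M N K" for Y
    proof -
      obtain y where y: "y \<in> N" "Y = K +>\<^bsub>M\<^esub> y"
        using \<open>Y \<in> _\<close> by (auto simp: quotient_submodule_def)
      then have yc: "y \<in> carrier M" using NE(1) by blast
      show ?thesis
        unfolding x(2) y(2) coset_add[OF K xc yc] quotient_submodule_def
        using NE(5)[OF x(1) y(1)] by (rule imageI)
    qed
  qed
qed

text \<open>
  Passing from a weakly \<open>S\<close>-primary submodule \<open>K'\<close> of \<open>M\<close> to \<open>K' \<inter> N\<close> can lose the condition
  \<open>(K' \<inter> N :\<^sub>R N) \<inter> S = \<emptyset>\<close>, for instance whenever \<open>N \<subseteq> K'\<close>. So this condition has to be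
  required separately.
\<close>

lemma not_weakly_S_primary_inter:
  assumes "submodule N R M" "mult_closed_subset R S" "N \<subseteq> K'"
  shows "\<not> weakly_S_primary R S (M\<lparr>carrier := N\<rparr>) (K' \<inter> N)"
proof -
  have "residual R (M\<lparr>carrier := N\<rparr>) (K' \<inter> N) = carrier R"
    using submoduleE(4)[OF assms(1)] assms(3) by (auto simp: residual_def)
  then show ?thesis using assms(2) by (auto simp: weakly_S_primary_def mult_closed_subset_def)
qed

end

end

theory Submission
  imports Defs
begin

text \<open>
  A nonzero multiple \<open>a (K + x)\<close> in \<open>M/K\<close> is one with \<open>a x \<notin> K\<close>, and \<open>(N/K : M/K) = (N : M)\<close>. So
  \<open>N/K\<close> being weakly \<open>S\<close>-primary says exactly that \<open>N\<close> satisfies the \<open>S\<close>-primary condition on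
  products lying in \<open>N - K\<close>. For part (3), products in \<open>K\<close> are handled by a witness \<open>t\<close> for \<open>K\<close> and
  products in \<open>N - K\<close> by a witness \<open>s\<close> for \<open>N/K\<close>; then \<open>s t\<close> is a witness for \<open>N\<close>.
\<close>

context module
begin

lemma residual_smult_closed:
  assumes N: "submodule N R M" and c: "c \<in> carrier R" and r: "r \<in> residual R M N"
  shows "c \<otimes>\<^bsub>R\<^esub> r \<in> residual R M N"
  using c r submoduleE(4)[OF N c] by (auto simp: residual_def smult_assoc1)

text \<open>By commutativity \<open>(c r)^n = c^n r^n\<close>, so an exponent that works for
  \<open>r\<close> works for \<open>c r\<close>. This absorbs the extra factor of a product of two
  witnesses.\<close>

lemma radical_residual_smult_closed:
  assumes N: "submodule N R M" and c: "c \<in> carrier R" and r: "r \<in> radical R (residual R M N)"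
  shows "c \<otimes>\<^bsub>R\<^esub> r \<in> radical R (residual R M N)"
proof -
  obtain n :: nat where n: "r \<in> carrier R" "n > 0" "r [^]\<^bsub>R\<^esub> n \<in> residual R M N"
    using r by (auto simp: radical_def)
  have "(c \<otimes>\<^bsub>R\<^esub> r) [^]\<^bsub>R\<^esub> n \<in> residual R M N"
    using residual_smult_closed[OF N _ n(3), of "c [^]\<^bsub>R\<^esub> n"] c n(1)
    by (simp add: R.nat_pow_distrib)
  then show ?thesis using c n by (auto simp: radical_def)
qed

lemma residual_mono: "N \<subseteq> N' \<Longrightarrow> residual R M N \<subseteq> residual R M N'"
  by (auto simp: residual_def)

lemma radical_mono: "I \<subseteq> J \<Longrightarrow> radical R I \<subseteq> radical R J"
  by (auto simp: radical_def)

text \<open>If \<open>K + x = K + n\<close> with \<open>n\<close> in \<open>N\<close>, then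
  \<open>x - n\<close> lies in \<open>K \<subseteq> N\<close>, and \<open>x = (x - n) + n\<close>
  lies in \<open>N\<close>.\<close>

lemma coset_in_quotient_submodule_iff:
  assumes K: "submodule K R M" and N: "submodule N R M" and KN: "K \<subseteq> N"
    and x: "x \<in> carrier M"
  shows "K +>\<^bsub>M\<^esub> x \<in> quotient_submodule M N K \<longleftrightarrow> x \<in> N"
proof
  assume "K +>\<^bsub>M\<^esub> x \<in> quotient_submodule M N K"
  then obtain n where n: "n \<in> N" "K +>\<^bsub>M\<^esub> x = K +>\<^bsub>M\<^esub> n"
    by (auto simp: quotient_submodule_def)
  then have nc: "n \<in> carrier M" using submoduleE(1)[OF N] by blast
  have "x \<ominus>\<^bsub>M\<^esub> n \<in> N" using n(2) coset_eq_iff[OF K x nc] KN by blast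
  then have "(x \<ominus>\<^bsub>M\<^esub> n) \<oplus>\<^bsub>M\<^esub> n \<in> N" using submoduleE(5)[OF N] n(1) by blast
  then show "x \<in> N" using x nc by (simp add: M.minus_eq M.a_assoc M.l_neg)
qed (auto simp: quotient_submodule_def)

lemma coset_eq_zero_iff:
  assumes K: "submodule K R M" and x: "x \<in> carrier M"
  shows "K +>\<^bsub>M\<^esub> x = \<zero>\<^bsub>quotient_module M K\<^esub> \<longleftrightarrow> x \<in> K"
  using M.a_coset_join1[OF _ x submodule.axioms(1)[OF K]]
    M.a_coset_join2[OF x submodule.axioms(1)[OF K]]
  by (auto simp: quotient_module_def)

text \<open>The product \<open>r (K + x) = K + r x\<close> lies in \<open>N/K\<close> exactly when
  \<open>r x\<close> lies in \<open>N\<close>. The radicals therefore agree as well.\<close>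

lemma residual_quotient:
  assumes K: "submodule K R M" and N: "submodule N R M" and KN: "K \<subseteq> N"
  shows "residual R (quotient_module M K) (quotient_submodule M N K) = residual R M N"
  by (auto simp: residual_def carrier_quotient_module smult_coset[OF K]
      coset_in_quotient_submodule_iff[OF K N KN])

text \<open>Every element of \<open>M/K\<close> is a coset of some \<open>m\<close>, so the
  condition on \<open>M/K\<close> can be pulled back to representatives in \<open>M\<close>.\<close>

lemma weakly_S_primary_quotient_iff:
  assumes S: "mult_closed_subset R S"
    and K: "submodule K R M" and N: "submodule N R M" and KN: "K \<subseteq> N"
  shows "weakly_S_primary R S (quotient_module M K) (quotient_submodule M N K) \<longleftrightarrow>
    residual R M N \<inter> S = {} \<and>
    (\<exists>s\<in>S. \<forall>a\<in>carrier R. \<forall>m\<in>carrier M.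
       a \<odot>\<^bsub>M\<^esub> m \<notin> K \<and> a \<odot>\<^bsub>M\<^esub> m \<in> N \<longrightarrow>
       s \<otimes>\<^bsub>R\<^esub> a \<in> radical R (residual R M N) \<or> s \<odot>\<^bsub>M\<^esub> m \<in> N)"
proof -
  \<comment> \<open>Rewriting \<open>s (K + m)\<close> as \<open>K + s m\<close> needs
    \<open>s\<close> in the carrier; \<open>bex_cong\<close> makes \<open>s \<in> S\<close>
    available under the quantifier.\<close>
  have "s \<in> carrier R" if "s \<in> S" for s
    using S that by (auto simp: mult_closed_subset_def)
  then show ?thesis
    by (simp add: weakly_S_primary_def quotient_submodule_is_submodule[OF K N]
        residual_quotient[OF K N KN] carrier_quotient_module smult_coset[OF K]
        coset_in_quotient_submodule_iff[OF K N KN] coset_eq_zero_iff[OF K]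
        eq_commute[of "\<zero>\<^bsub>quotient_module M K\<^esub>"] cong: bex_cong)
qed

text \<open>As \<open>0\<close> lies in \<open>K\<close>, a product outside \<open>K\<close> is
  nonzero, so the witness for \<open>N\<close> serves for \<open>N/K\<close> unchanged.\<close>

lemma weakly_S_primary_quotient:
  assumes S: "mult_closed_subset R S" and K: "submodule K R M" and KN: "K \<subseteq> N"
    and w: "weakly_S_primary R S M N"
  shows "weakly_S_primary R S (quotient_module M K) (quotient_submodule M N K)"
proof -
  have N: "submodule N R M" using w by (simp add: weakly_S_primary_def)
  have "\<zero>\<^bsub>M\<^esub> \<in> K" using subgroup.one_closed[OF submodule.axioms(1)[OF K]] by simp
  then show ?thesis
    using w weakly_S_primary_quotient_iff[OF S K N KN] unfolding weakly_S_primary_def[of R S M]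
    by metis
qed

lemma submodule_Int_restrict:
  assumes N: "submodule N R M" and K: "submodule K R M"
  shows "submodule (K \<inter> N) R (M\<lparr>carrier := N\<rparr>)"
proof -
  note NK = submodule.axioms(1)[OF N] submodule.axioms(1)[OF K]
  have "subgroup (K \<inter> N) ((add_monoid M)\<lparr>carrier := N\<rparr>)"
    using M.add.subgroup_incl[OF M.add.subgroups_Inter_pair[OF NK(2,1)] NK(1)] by simp
  then show ?thesis
    using submoduleE(4)[OF N] submoduleE(4)[OF K]
    by (auto intro!: submodule.intro simp: submodule_axioms_def)
qed

text \<open>The witness \<open>s\<close> for \<open>K\<close> is kept: for \<open>m\<close> in
  \<open>N\<close> also \<open>s m\<close> lies in \<open>N\<close>, so \<open>s m \<in> K\<close>
  gives \<open>s m \<in> K \<inter> N\<close>.\<close>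

lemma weakly_S_primary_restrict:
  assumes S: "mult_closed_subset R S" and N: "submodule N R M" and w: "weakly_S_primary R S M K"
    and disj: "residual R (M\<lparr>carrier := N\<rparr>) (K \<inter> N) \<inter> S = {}"
  shows "weakly_S_primary R S (M\<lparr>carrier := N\<rparr>) (K \<inter> N)"
proof -
  have K: "submodule K R M" using w by (simp add: weakly_S_primary_def)
  \<comment> \<open>If \<open>r M \<subseteq> K\<close>, then \<open>r N\<close> lies in
    \<open>K\<close> because \<open>N \<subseteq> M\<close>, and in \<open>N\<close> because
    \<open>N\<close> is closed under scalars.\<close>
  have "residual R M K \<subseteq> residual R (M\<lparr>carrier := N\<rparr>) (K \<inter> N)"
    using submoduleE(1,4)[OF N] by (auto simp: residual_def)
  then have rad: "radical R (residual R M K) \<subseteq> radical R (residual R (M\<lparr>carrier := N\<rparr>) (K \<inter> N))"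
    by (rule radical_mono)
  obtain s where s: "s \<in> S" and *: "\<And>a m. a \<in> carrier R \<Longrightarrow> m \<in> carrier M \<Longrightarrow>
      \<zero>\<^bsub>M\<^esub> \<noteq> a \<odot>\<^bsub>M\<^esub> m \<Longrightarrow> a \<odot>\<^bsub>M\<^esub> m \<in> K \<Longrightarrow>
      s \<otimes>\<^bsub>R\<^esub> a \<in> radical R (residual R M K) \<or> s \<odot>\<^bsub>M\<^esub> m \<in> K"
    using w by (auto simp: weakly_S_primary_def)
  have "s \<in> carrier R" using S s by (auto simp: mult_closed_subset_def)
  then show ?thesis
    unfolding weakly_S_primary_def
    using submodule_Int_restrict[OF N K] disj s submoduleE(4)[OF N]
      subsetD[OF rad] subsetD[OF submoduleE(1)[OF N]] *
    by (auto intro!: bexI[of _ s]) blast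
qed

text \<open>
  The predicate \<open>P\<close> covers the primary case (\<open>P\<close> always true) and the weakly primary case
  (\<open>P x \<longleftrightarrow> x \<noteq> 0\<close>) at once.
\<close>

lemma primary_condition_of_quotient:
  assumes S: "mult_closed_subset R S"
    and K: "submodule K R M" and N: "submodule N R M" and KN: "K \<subseteq> N"
    and q: "weakly_S_primary R S (quotient_module M K) (quotient_submodule M N K)"
    and k: "\<exists>t\<in>S. \<forall>a\<in>carrier R. \<forall>m\<in>carrier M. P (a \<odot>\<^bsub>M\<^esub> m) \<and> a \<odot>\<^bsub>M\<^esub> m \<in> K \<longrightarrow>
        t \<otimes>\<^bsub>R\<^esub> a \<in> radical R (residual R M K) \<or> t \<odot>\<^bsub>M\<^esub> m \<in> K"
  shows "\<exists>s\<in>S. \<forall>a\<in>carrier R. \<forall>m\<in>carrier M. P (a \<odot>\<^bsub>M\<^esub> m) \<and> a \<odot>\<^bsub>M\<^esub> m \<in> N \<longrightarrow>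
        s \<otimes>\<^bsub>R\<^esub> a \<in> radical R (residual R M N) \<or> s \<odot>\<^bsub>M\<^esub> m \<in> N"
proof -
  let ?rad = "radical R (residual R M N)"
  obtain s where s: "s \<in> S" and s': "\<And>a m. a \<in> carrier R \<Longrightarrow> m \<in> carrier M \<Longrightarrow>
      a \<odot>\<^bsub>M\<^esub> m \<notin> K \<Longrightarrow> a \<odot>\<^bsub>M\<^esub> m \<in> N \<Longrightarrow> s \<otimes>\<^bsub>R\<^esub> a \<in> ?rad \<or> s \<odot>\<^bsub>M\<^esub> m \<in> N"
    using q unfolding weakly_S_primary_quotient_iff[OF S K N KN] by blast
  \<comment> \<open>Since \<open>K \<subseteq> N\<close>, both alternatives that the witness for
    \<open>K\<close> offers remain true with \<open>N\<close> in place of \<open>K\<close>.\<close>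
  obtain t where t: "t \<in> S" and t': "\<And>a m. a \<in> carrier R \<Longrightarrow> m \<in> carrier M \<Longrightarrow>
      P (a \<odot>\<^bsub>M\<^esub> m) \<Longrightarrow> a \<odot>\<^bsub>M\<^esub> m \<in> K \<Longrightarrow> t \<otimes>\<^bsub>R\<^esub> a \<in> ?rad \<or> t \<odot>\<^bsub>M\<^esub> m \<in> N"
    using k radical_mono[OF residual_mono[OF KN]] KN by blast
  have c: "s \<in> carrier R" "t \<in> carrier R" and st: "s \<otimes>\<^bsub>R\<^esub> t \<in> S"
    using S s t by (auto simp: mult_closed_subset_def)
  have "(s \<otimes>\<^bsub>R\<^esub> t) \<otimes>\<^bsub>R\<^esub> a \<in> ?rad \<or> (s \<otimes>\<^bsub>R\<^esub> t) \<odot>\<^bsub>M\<^esub> m \<in> N"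
    if a: "a \<in> carrier R" and m: "m \<in> carrier M"
      and P: "P (a \<odot>\<^bsub>M\<^esub> m)" and am: "a \<odot>\<^bsub>M\<^esub> m \<in> N" for a m
  proof (cases "a \<odot>\<^bsub>M\<^esub> m \<in> K")
    case True
    \<comment> \<open>The product is regrouped so that \<open>t\<close>, the witness for products in
      \<open>K\<close>, acts first; multiplying by \<open>s\<close> then stays in the radical or in
      \<open>N\<close>.\<close>
    have "(s \<otimes>\<^bsub>R\<^esub> t) \<otimes>\<^bsub>R\<^esub> a = s \<otimes>\<^bsub>R\<^esub> (t \<otimes>\<^bsub>R\<^esub> a)"
      and "(s \<otimes>\<^bsub>R\<^esub> t) \<odot>\<^bsub>M\<^esub> m = s \<odot>\<^bsub>M\<^esub> (t \<odot>\<^bsub>M\<^esub> m)"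
      using a c m by (simp_all add: R.m_assoc smult_assoc1)
    then show ?thesis
      using t'[OF a m P True] radical_residual_smult_closed[OF N c(1)] submoduleE(4)[OF N c(1)]
      by metis
  next
    case False
    \<comment> \<open>Outside \<open>K\<close> the roles are exchanged: \<open>s\<close> acts first,
      which uses commutativity of \<open>R\<close>.\<close>
    have "(s \<otimes>\<^bsub>R\<^esub> t) \<otimes>\<^bsub>R\<^esub> a = t \<otimes>\<^bsub>R\<^esub> (s \<otimes>\<^bsub>R\<^esub> a)"
      and "(s \<otimes>\<^bsub>R\<^esub> t) \<odot>\<^bsub>M\<^esub> m = t \<odot>\<^bsub>M\<^esub> (s \<odot>\<^bsub>M\<^esub> m)"
      using a c m by (simp_all add: R.m_ac flip: smult_assoc1)
    then show ?thesis
      using s'[OF a m False am] radical_residual_smult_closed[OF N c(2)] submoduleE(4)[OF N c(2)]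
      by metis
  qed
  then show ?thesis using st by blast
qed

text \<open>Disjointness from \<open>S\<close> comes from \<open>N/K\<close>, whose residual is that
  of \<open>N\<close>; the residual of \<open>K\<close> may be strictly smaller.\<close>

lemma S_primary_of_quotient:
  assumes "mult_closed_subset R S" "submodule K R M" "submodule N R M" "K \<subseteq> N"
    and "weakly_S_primary R S (quotient_module M K) (quotient_submodule M N K)"
    and "S_primary R S M K"
  shows "S_primary R S M N"
  using assms weakly_S_primary_quotient_iff[OF assms(1-4)]
    primary_condition_of_quotient[OF assms(1-5), of "\<lambda>_. True"]
  by (simp add: S_primary_def)

lemma weakly_S_primary_of_quotient:
  assumes "mult_closed_subset R S" "submodule K R M" "submodule N R M" "K \<subseteq> N"
    and "weakly_S_primary R S (quotient_module M K) (quotient_submodule M N K)"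
    and "weakly_S_primary R S M K"
  shows "weakly_S_primary R S M N"
  using assms(3,6) assms(5)[unfolded weakly_S_primary_quotient_iff[OF assms(1-4)]]
    primary_condition_of_quotient[OF assms(1-5), of "\<lambda>x. \<zero>\<^bsub>M\<^esub> \<noteq> x"]
  by (simp add: weakly_S_primary_def)

end

theorem corollary3:
  fixes R :: "('a, 'r) ring_scheme"
    and M :: "('a, 'b, 'm) module_scheme"
    and S :: "'a set" and K N :: "'b set"
  assumes "module R M"
    and "mult_closed_subset R S"
    and "submodule K R M" and "submodule N R M" and "K \<subseteq> N"
  shows
    "(weakly_S_primary R S M N \<longrightarrow>
        weakly_S_primary R S (quotient_module M K) (quotient_submodule M N K)) \<and>
     (\<forall>K'. weakly_S_primary R S M K' \<and>
        residual R (M\<lparr>carrier := N\<rparr>) (K' \<inter> N) \<inter> S = {} \<longrightarrow>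
        weakly_S_primary R S (M\<lparr>carrier := N\<rparr>) (K' \<inter> N)) \<and>
     (weakly_S_primary R S (quotient_module M K) (quotient_submodule M N K) \<and>
        S_primary R S M K \<longrightarrow> S_primary R S M N) \<and>
     (weakly_S_primary R S (quotient_module M K) (quotient_submodule M N K) \<and>
        weakly_S_primary R S M K \<longrightarrow> weakly_S_primary R S M N)"
  using module.weakly_S_primary_quotient[OF assms(1,2,3,5)]
    module.weakly_S_primary_restrict[OF assms(1,2,4)]
    module.S_primary_of_quotient[OF assms] module.weakly_S_primary_of_quotient[OF assms]
  by blast

end
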